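(* Let $\bar\varphi$ be the (unique) fixed point of $T$ and define $H:L^V\to\mathbb R$ by $H(x)=\sum_{i\in V}\bar\varphi_i(x_i)$. Then $\bar\varphi_i(\tau)\ge 0$ for all $i\in V$, $\tau\in L$, and $H(x)\le F(x)$ for all $x\in L^V$.
   Context: Let $G=(V,E)$ be an undirected, simple, connected graph with $V=\{1,\dots,n\}$, $n\ge 2$. For $i\in V$ let $N(i)=\{j\in V:\{i,j\}\in E\}$. Let $L$ be a finite set of labels. For each $i\in V$ let $g_i:L\to[0,\infty)$, and for each $\{i,j\}\in E$ let $h_{ij},h_{ji}:L^2\to[0,\infty)$ with $h_{ij}(a,b)=h_{ji}(b,a)$. The energy $F:L^V\to\mathbb R$ is $F(x)=\sum_{i\in V}g_i(x_i)+\sum_{\{i,j\}\in E}h_{ij}(x_i,x_j)$. Fix $p\in(0,1)$, $q=1-p$, and weights $w_{ij}\in[0,1]$ for $i\in V$, $j\in N(i)$, with $\sum_{j\in N(i)}w_{ij}=1$ for every $i\in V$. Let $\mathcal{F}$ be the set of tuples $\varphi=(\varphi_1,\dots,\varphi_n)$ with $\varphi_i:L\to\mathbb{R}$. The map $T:\mathcal F\to\mathcal F$ is defined by \[ (T\varphi)_i(\tau)=p\,g_i(\tau)+\sum_{j\in N(i)}\min_{u_j\in L}\Big(\tfrac{p}{2}h_{ij}(\tau,u_j)+q\,w_{ji}\,\varphi_j(u_j)\Big). \] (The map $T$ has a unique fixed point.) *)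

theory Defs
  imports Complex_Main "HOL-Library.FuncSet"
begin

definition simple_graph :: "'v set \<Rightarrow> 'v set set \<Rightarrow> bool" where
  "simple_graph V E \<longleftrightarrow> finite V \<and> (\<forall>e\<in>E. \<exists>i\<in>V. \<exists>j\<in>V. i \<noteq> j \<and> e = {i, j})"

definition connected_graph :: "'v set \<Rightarrow> 'v set set \<Rightarrow> bool" where
  "connected_graph V E \<longleftrightarrow> V \<noteq> {} \<and> (\<forall>i\<in>V. \<forall>j\<in>V. (i, j) \<in> {(u, v). {u, v} \<in> E}\<^sup>*)"

definition nbrs :: "'v set \<Rightarrow> 'v set set \<Rightarrow> 'v \<Rightarrow> 'v set" where
  "nbrs V E i = {j \<in> V. {i, j} \<in> E}"

text \<open>
  Each undirected edge is counted once, through its representative with \<open>i < j\<close>;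
  since \<open>h i j a b = h j i b a\<close>, the choice of orientation is immaterial.
\<close>

definition energy ::
  "'v::linorder set \<Rightarrow> 'v set set \<Rightarrow> ('v \<Rightarrow> 'l \<Rightarrow> real) \<Rightarrow> ('v \<Rightarrow> 'v \<Rightarrow> 'l \<Rightarrow> 'l \<Rightarrow> real) \<Rightarrow>
    ('v \<Rightarrow> 'l) \<Rightarrow> real" where
  "energy V E g h x =
    (\<Sum>i\<in>V. g i (x i)) +
    (\<Sum>(i, j) \<in> {(i, j). i \<in> V \<and> j \<in> V \<and> i < j \<and> {i, j} \<in> E}. h i j (x i) (x j))"

text \<open>
  Tuples of functions on \<open>L\<close> indexed by \<open>V\<close> are extensional functions, so that equality of
  tuples is equality on \<open>V\<close> and \<open>L\<close> and a fixed point is literally a solution of \<open>T \<phi> = \<phi>\<close>.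
\<close>

definition fun_tuples :: "'v set \<Rightarrow> 'l set \<Rightarrow> ('v \<Rightarrow> 'l \<Rightarrow> real) set" where
  "fun_tuples V L = V \<rightarrow>\<^sub>E (L \<rightarrow>\<^sub>E UNIV)"

definition T_map ::
  "'v set \<Rightarrow> 'v set set \<Rightarrow> 'l set \<Rightarrow> ('v \<Rightarrow> 'l \<Rightarrow> real) \<Rightarrow> ('v \<Rightarrow> 'v \<Rightarrow> 'l \<Rightarrow> 'l \<Rightarrow> real) \<Rightarrow>
    real \<Rightarrow> real \<Rightarrow> ('v \<Rightarrow> 'v \<Rightarrow> real) \<Rightarrow> ('v \<Rightarrow> 'l \<Rightarrow> real) \<Rightarrow> ('v \<Rightarrow> 'l \<Rightarrow> real)" where
  "T_map V E L g h p q w \<phi> =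
    (\<lambda>i\<in>V. \<lambda>\<tau>\<in>L. p * g i \<tau> +
      (\<Sum>j\<in>nbrs V E i. MIN u\<in>L. p / 2 * h i j \<tau> u + q * w j i * \<phi> j u))"

end

theory Submission
  imports Defs
begin

text \<open>
  Bounding each minimum in \<open>T \<phi> = \<phi>\<close> by its value at \<open>u = x j\<close> and summing over the vertices
  gives \<open>H x \<le> p F x + q H x\<close>, because the weights leaving each vertex sum to \<open>1\<close>; dividing
  by \<open>p = 1 - q\<close> gives \<open>H x \<le> F x\<close>. For nonnegativity, let \<open>m i\<close> be the negative part of
  the minimum of \<open>\<phi> i\<close>. The fixed point equation yields \<open>m i \<le> q \<Sum>\<^sub>j w j i * m j\<close>, and
  summing over the vertices yields \<open>\<Sum> m \<le> q \<Sum> m\<close>, so \<open>m\<close> vanishes.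
\<close>

lemma mem_nbrs_commute:
  "i \<in> V \<and> j \<in> nbrs V E i \<longleftrightarrow> j \<in> V \<and> i \<in> nbrs V E j"
  by (auto simp: nbrs_def insert_commute)

text \<open>Adjacency is symmetric, so both sides sum over the same ordered pairs of adjacent
  vertices.\<close>

lemma sum_nbrs_swap:
  fixes f :: "'v \<Rightarrow> 'v \<Rightarrow> 'a::comm_monoid_add"
  assumes "finite V"
  shows "(\<Sum>i\<in>V. \<Sum>j\<in>nbrs V E i. f i j) = (\<Sum>j\<in>V. \<Sum>i\<in>nbrs V E j. f i j)"
proof -
  have "(\<Sum>i\<in>V. \<Sum>j\<in>nbrs V E i. f i j) = (\<Sum>j\<in>V. \<Sum>i | i \<in> V \<and> {i, j} \<in> E. f i j)"
    using sum.swap_restrict[OF assms assms, of f "\<lambda>i j. {i, j} \<in> E"] by (simp add: nbrs_def)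
  then show ?thesis
    by (simp add: nbrs_def insert_commute)
qed

text \<open>After the exchange of sums, \<open>f j\<close> is multiplied by the total weight leaving
  \<open>j\<close>, which is \<open>1\<close>. This conservation of mass serves both halves of the
  theorem: once for the negative parts \<open>m\<close>, once for the values
  \<open>\<phi> j (x j)\<close>.\<close>

lemma sum_nbrs_weighted:
  fixes f :: "'v \<Rightarrow> real"
  assumes "finite V" and "\<And>i. i \<in> V \<Longrightarrow> (\<Sum>j\<in>nbrs V E i. w i j) = 1"
  shows "(\<Sum>i\<in>V. \<Sum>j\<in>nbrs V E i. w j i * f j) = (\<Sum>j\<in>V. f j)"
proof -
  have "(\<Sum>i\<in>V. \<Sum>j\<in>nbrs V E i. w j i * f j) = (\<Sum>j\<in>V. (\<Sum>i\<in>nbrs V E j. w j i) * f j)"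
    by (subst sum_nbrs_swap[OF assms(1)]) (simp add: sum_distrib_right)
  also have "\<dots> = (\<Sum>j\<in>V. f j)"
    using assms(2) by simp
  finally show ?thesis .
qed

text \<open>Every edge is seen from both of its ends. The factor \<open>2\<close> cancels the
  \<open>1/2\<close> in the coefficient \<open>p / 2\<close> of \<open>T_map\<close>.\<close>

lemma sum_nbrs_eq_double_edge_sum:
  fixes V :: "'v::linorder set" and k :: "'v \<Rightarrow> 'v \<Rightarrow> real"
  assumes "simple_graph V E" and sym: "\<And>i j. {i, j} \<in> E \<Longrightarrow> k i j = k j i"
  shows "(\<Sum>i\<in>V. \<Sum>j\<in>nbrs V E i. k i j) =
    2 * (\<Sum>(i, j) \<in> {(i, j). i \<in> V \<and> j \<in> V \<and> i < j \<and> {i, j} \<in> E}. k i j)"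
proof -
  let ?A = "{(i, j). i \<in> V \<and> j \<in> V \<and> i < j \<and> {i, j} \<in> E}"
  let ?B = "{(i, j). i \<in> V \<and> j \<in> V \<and> j < i \<and> {i, j} \<in> E}"
  have fin: "finite V" and loop: "{i} \<notin> E" for i
    using assms(1) by (auto simp: simple_graph_def)
  have "finite ?A" "finite ?B"
    by (rule finite_subset[of _ "V \<times> V"]; use fin in auto)+
  \<comment> \<open>Without loops the diagonal contributes no pair, so the order splits the adjacent
    pairs into two mirror images.\<close>
  have AB: "Sigma V (nbrs V E) = ?A \<union> ?B"
    using loop by (auto simp: nbrs_def) (metis insert_absorb2 neqE)
  have B: "?B = prod.swap ` ?A"
    by (auto simp: insert_commute image_iff)
  have "(\<Sum>i\<in>V. \<Sum>j\<in>nbrs V E i. k i j) = (\<Sum>(i, j)\<in>?A \<union> ?B. k i j)"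
    using fin by (subst sum.Sigma) (auto simp: AB nbrs_def)
  also have "\<dots> = (\<Sum>(i, j)\<in>?A. k i j) + (\<Sum>(i, j)\<in>?B. k i j)"
    by (rule sum.union_disjoint) (use \<open>finite ?A\<close> \<open>finite ?B\<close> in auto)
  also have "(\<Sum>(i, j)\<in>?B. k i j) = (\<Sum>(i, j)\<in>?A. k i j)"
    unfolding B by (subst sum.reindex) (auto intro!: sum.cong dest: sym)
  finally show ?thesis by simp
qed

lemma fixed_point_eq:
  assumes "T_map V E L g h p q w \<phi> = \<phi>" and "i \<in> V" and "\<tau> \<in> L"
  shows "\<phi> i \<tau> = p * g i \<tau> + (\<Sum>j\<in>nbrs V E i. MIN u\<in>L. p / 2 * h i j \<tau> u + q * w j i * \<phi> j u)"
proof -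
  have "\<phi> i \<tau> = T_map V E L g h p q w \<phi> i \<tau>"
    by (simp add: assms(1))
  then show ?thesis
    using assms(2,3) by (simp add: T_map_def)
qed

lemma fixed_point_nonneg:
  fixes p q :: real
  assumes fin: "finite V" "finite L"
    and g: "\<And>i a. i \<in> V \<Longrightarrow> a \<in> L \<Longrightarrow> g i a \<ge> 0"
    and h: "\<And>i j a b. {i, j} \<in> E \<Longrightarrow> a \<in> L \<Longrightarrow> b \<in> L \<Longrightarrow> h i j a b \<ge> 0"
    and pq: "0 \<le> p" "0 \<le> q" "q < 1"
    and w: "\<And>i j. i \<in> V \<Longrightarrow> j \<in> nbrs V E i \<Longrightarrow> w i j \<ge> 0"
    and w1: "\<And>i. i \<in> V \<Longrightarrow> (\<Sum>j\<in>nbrs V E i. w i j) = 1"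
    and fp: "T_map V E L g h p q w \<phi> = \<phi>"
    and i: "i \<in> V" and \<tau>: "\<tau> \<in> L"
  shows "\<phi> i \<tau> \<ge> 0"
proof -
  \<comment> \<open>Truncation at \<open>0\<close> makes \<open>m\<close> nonnegative, so a bound on
    its sum controls each term, while \<open>- m i\<close> still bounds \<open>\<phi> i\<close> from
    below.\<close>
  define m where "m i = max 0 (- (MIN u\<in>L. \<phi> i u))" for i
  \<comment> \<open>The label \<open>\<tau>\<close> witnesses that \<open>L\<close> is nonempty, so
    the minima are genuine.\<close>
  have L: "finite (\<phi> i ` L)" "\<phi> i ` L \<noteq> {}" for i
    using fin \<tau> by auto
  have lower: "- m i \<le> \<phi> i u" if "u \<in> L" for i u
  proof -
    have "(MIN u\<in>L. \<phi> i u) \<le> \<phi> i u"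
      using that fin by (intro Min_le) auto
    then show ?thesis by (simp add: m_def)
  qed
  have m_le: "m i \<le> q * (\<Sum>j\<in>nbrs V E i. w j i * m j)" if i: "i \<in> V" for i
  proof -
    have w': "0 \<le> w j i" if "j \<in> nbrs V E i" for j
      using that i w mem_nbrs_commute by metis
    have "- (q * (\<Sum>j\<in>nbrs V E i. w j i * m j)) \<le> \<phi> i a" if a: "a \<in> L" for a
    proof -
      have "(\<Sum>j\<in>nbrs V E i. - (q * (w j i * m j))) \<le>
        (\<Sum>j\<in>nbrs V E i. MIN u\<in>L. p / 2 * h i j a u + q * w j i * \<phi> j u)"
      proof (rule sum_mono)
        fix j assume j: "j \<in> nbrs V E i"
        have "- (q * (w j i * m j)) \<le> p / 2 * h i j a u + q * w j i * \<phi> j u" if "u \<in> L" for u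
        proof -
          have "0 \<le> p / 2 * h i j a u"
            using h j a that pq by (auto simp: nbrs_def)
          moreover have "q * w j i * (- m j) \<le> q * w j i * \<phi> j u"
            using lower[OF that] w'[OF j] pq by (intro mult_left_mono) auto
          ultimately show ?thesis by (simp add: mult.assoc)
        qed
        then show "- (q * (w j i * m j)) \<le> (MIN u\<in>L. p / 2 * h i j a u + q * w j i * \<phi> j u)"
          using fin \<tau> by (subst Min_ge_iff) auto
      qed
      moreover have "0 \<le> p * g i a"
        using g i a pq by simp
      ultimately show ?thesis
        by (subst fixed_point_eq[OF fp i a]) (simp add: sum_distrib_left sum_negf)
    qed
    then have "- (q * (\<Sum>j\<in>nbrs V E i. w j i * m j)) \<le> (MIN u\<in>L. \<phi> i u)"
      using L[of i] by (subst Min_ge_iff) auto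
    \<comment> \<open>This settles the case where the maximum in \<open>m i\<close> is
      \<open>0\<close>.\<close>
    moreover have "0 \<le> q * (\<Sum>j\<in>nbrs V E i. w j i * m j)"
      using pq w' by (intro mult_nonneg_nonneg sum_nonneg) (auto simp: m_def)
    ultimately show ?thesis by (simp add: m_def)
  qed
  have m0: "0 \<le> m i" for i
    by (simp add: m_def)
  have "(\<Sum>i\<in>V. m i) \<le> (\<Sum>i\<in>V. q * (\<Sum>j\<in>nbrs V E i. w j i * m j))"
    by (intro sum_mono m_le)
  also have "\<dots> = q * (\<Sum>i\<in>V. m i)"
    using sum_nbrs_weighted[OF fin(1) w1, of m] by (simp flip: sum_distrib_left)
  \<comment> \<open>Summation has removed the weights, leaving a contraction by
    \<open>q < 1\<close>.\<close>
  finally have "(1 - q) * (\<Sum>i\<in>V. m i) \<le> 0"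
    by (simp add: algebra_simps)
  then have "(\<Sum>i\<in>V. m i) \<le> 0"
    using pq by (simp add: mult_le_0_iff)
  then have "m i \<le> 0"
    using member_le_sum[OF i, of m] m0 fin by fastforce
  then show ?thesis
    using lower[OF \<tau>, of i] by simp
qed

lemma fixed_point_sum_le_energy:
  fixes V :: "'v::linorder set" and p q :: real
  assumes G: "simple_graph V E" and L: "finite L"
    and sym: "\<And>i j a b. {i, j} \<in> E \<Longrightarrow> a \<in> L \<Longrightarrow> b \<in> L \<Longrightarrow> h i j a b = h j i b a"
    and pq: "0 < p" "q = 1 - p"
    and w1: "\<And>i. i \<in> V \<Longrightarrow> (\<Sum>j\<in>nbrs V E i. w i j) = 1"
    and fp: "T_map V E L g h p q w \<phi> = \<phi>"
    and x: "\<And>i. i \<in> V \<Longrightarrow> x i \<in> L"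
  shows "(\<Sum>i\<in>V. \<phi> i (x i)) \<le> energy V E g h x"
proof -
  let ?H = "\<Sum>i\<in>V. \<phi> i (x i)"
  \<comment> \<open>The symmetry of \<open>h\<close> is assumed only for labels in \<open>L\<close>,
    and \<open>x\<close> takes values in \<open>L\<close> only on \<open>V\<close>; hence the
    endpoints of an edge must be placed in \<open>V\<close>.\<close>
  have E: "i \<in> V \<and> j \<in> V" if "{i, j} \<in> E" for i j
    using G that by (auto simp: simple_graph_def doubleton_eq_iff)
  have V: "finite V"
    using G by (simp add: simple_graph_def)
  have "?H \<le> (\<Sum>i\<in>V. p * g i (x i) +
      (\<Sum>j\<in>nbrs V E i. p / 2 * h i j (x i) (x j) + q * w j i * \<phi> j (x j)))"
  proof (rule sum_mono)
    fix i assume i: "i \<in> V"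
    show "\<phi> i (x i) \<le> p * g i (x i) +
      (\<Sum>j\<in>nbrs V E i. p / 2 * h i j (x i) (x j) + q * w j i * \<phi> j (x j))"
      by (subst fixed_point_eq[OF fp i x[OF i]], intro add_left_mono sum_mono Min_le)
        (use L x in \<open>auto simp: nbrs_def\<close>)
  qed
  also have "\<dots> = p * (\<Sum>i\<in>V. g i (x i)) + p / 2 * (\<Sum>i\<in>V. \<Sum>j\<in>nbrs V E i. h i j (x i) (x j))
      + q * (\<Sum>i\<in>V. \<Sum>j\<in>nbrs V E i. w j i * \<phi> j (x j))"
    by (simp add: sum.distrib sum_distrib_left mult.assoc)
  also have "\<dots> = p * energy V E g h x + q * ?H"
  proof -
    have "(\<Sum>i\<in>V. \<Sum>j\<in>nbrs V E i. h i j (x i) (x j)) =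
      2 * (\<Sum>(i, j) \<in> {(i, j). i \<in> V \<and> j \<in> V \<and> i < j \<and> {i, j} \<in> E}. h i j (x i) (x j))"
      by (rule sum_nbrs_eq_double_edge_sum[OF G]) (use E x sym in blast)
    then show ?thesis
      using sum_nbrs_weighted[OF V w1, of "\<lambda>j. \<phi> j (x j)"]
      by (simp add: energy_def distrib_left)
  qed
  \<comment> \<open>Moving \<open>q * ?H\<close> to the left leaves the factor
    \<open>1 - q = p\<close>.\<close>
  finally have "p * ?H \<le> p * energy V E g h x"
    using pq by (simp add: algebra_simps)
  then show ?thesis
    using pq by simp
qed

theorem theorem2:
  fixes n :: nat and V :: "nat set" and E :: "nat set set" and L :: "'l set"
    and g :: "nat \<Rightarrow> 'l \<Rightarrow> real" and h :: "nat \<Rightarrow> nat \<Rightarrow> 'l \<Rightarrow> 'l \<Rightarrow> real"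
    and p q :: real and w :: "nat \<Rightarrow> nat \<Rightarrow> real"
    and \<phi> :: "nat \<Rightarrow> 'l \<Rightarrow> real" and H :: "(nat \<Rightarrow> 'l) \<Rightarrow> real"
  assumes "n \<ge> 2" and "V = {1..n}"
    and "simple_graph V E" and "connected_graph V E"
    and "finite L"
    and "\<And>i a. i \<in> V \<Longrightarrow> a \<in> L \<Longrightarrow> g i a \<ge> 0"
    and "\<And>i j a b. {i, j} \<in> E \<Longrightarrow> a \<in> L \<Longrightarrow> b \<in> L \<Longrightarrow> h i j a b \<ge> 0"
    and "\<And>i j a b. {i, j} \<in> E \<Longrightarrow> a \<in> L \<Longrightarrow> b \<in> L \<Longrightarrow> h i j a b = h j i b a"
    and "0 < p" and "p < 1" and "q = 1 - p"
    and "\<And>i j. i \<in> V \<Longrightarrow> j \<in> nbrs V E i \<Longrightarrow> w i j \<in> {0..1}"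
    and "\<And>i. i \<in> V \<Longrightarrow> (\<Sum>j\<in>nbrs V E i. w i j) = 1"
    and "\<phi> \<in> fun_tuples V L" and "T_map V E L g h p q w \<phi> = \<phi>"
    and "\<And>x. x \<in> V \<rightarrow>\<^sub>E L \<Longrightarrow> H x = (\<Sum>i\<in>V. \<phi> i (x i))"
  shows "(\<forall>i\<in>V. \<forall>\<tau>\<in>L. \<phi> i \<tau> \<ge> 0) \<and> (\<forall>x \<in> V \<rightarrow>\<^sub>E L. H x \<le> energy V E g h x)"
proof (intro conjI ballI)
  have V: "finite V"
    using assms(2) by simp
  show "\<phi> i \<tau> \<ge> 0" if "i \<in> V" "\<tau> \<in> L" for i \<tau>
    by (rule fixed_point_nonneg[OF V assms(5,6,7) _ _ _ _ assms(13,15) that])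
      (use assms(9-12) in auto)
  show "H x \<le> energy V E g h x" if "x \<in> V \<rightarrow>\<^sub>E L" for x
    unfolding assms(16)[OF that]
    by (rule fixed_point_sum_le_energy[OF assms(3,5,8,9,11,13,15)]) (use that in auto)
qed

end
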